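(* Let $M$ be a smooth finite-dimensional manifold, let $G$ be a Lie group with Lie algebra $\mathfrak{g}$ acting smoothly and properly on $M$, and let $X$ be a smooth $G$-equivariant vector field on $M$ with flow $F_t$, $t\in\mathbb{R}$. Let $m\in M$ be a relative equilibrium of $X$. Suppose there exists a smooth $G$-invariant function $f\colon M\to\mathbb{R}$ such that (1) $m$ is a critical point of $f$, with $f$ normalized so that $f(m)=0$; (2) the bilinear form $D^{2}f(m)$ on $T_mM$ is positive semi-definite with kernel $\mathfrak{g}\cdot m$; and (3) for every $\epsilon>0$ there exists an open neighborhood $V_\epsilon$ of $m$ such that $f(F_t(V_\epsilon))\subset[0,\epsilon)$ for all $t>0$. Then $m$ is $G$-stable.
   Context: An element $m\in M$ is a relative equilibrium of $X$ if there is $\xi\in\mathfrak{g}$ such that the curve $t\mapsto(\exp t\xi)\cdot m$ is a trajectory of $X$. The flow $F_t$ is taken to be defined for all $t\in\mathbb{R}$. $\mathfrak{g}\cdot m\subseteq T_mM$ denotes the tangent space at $m$ to the orbit $G\cdot m$, i.e. the set of values at $m$ of the infinitesimal generators of the action. $D^2f(m)$ is the Hessian of $f$ at the critical point $m$. For a subgroup $G'$ of $G$, a relative equilibrium $m$ is $G'$-stable (stable modulo $G'$) if for every $G'$-invariant open neighborhood $U$ of $G'\cdot m$ there exists an open neighborhood $V$ of $m$ in $U$ such that $F_t(V)\subseteq U$ for all $t\ge 0$; $G$-stable is the case $G'=G$. *)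

theory Defs
  imports "HOL-Analysis.Analysis" "HOL-Algebra.Group_Action"
begin

section \<open>Smooth maps between finite-dimensional vector spaces\<close>

text \<open>Model spaces have sort \<open>{real_inner, heine_borel}\<close> rather than \<open>euclidean_space\<close>: the
  latter requires a non-empty basis and would exclude zero-dimensional manifolds, in particular
  discrete Lie groups. Finite dimension is demanded explicitly in \<open>smooth_manifold\<close>.\<close>

definition finite_dimensional :: "'e::real_vector itself \<Rightarrow> bool" where
  "finite_dimensional _ \<longleftrightarrow> (\<exists>S::'e set. finite S \<and> span S = UNIV)"

text \<open>Meant for open \<open>S\<close> in a finite-dimensional space, where \<open>C\<^sup>k\<close> is the same as
  iterated continuous differentiability in every direction.\<close>

primrec k_smooth_on ::
    "nat \<Rightarrow> 'a::real_normed_vector set \<Rightarrow> ('a \<Rightarrow> 'b::real_normed_vector) \<Rightarrow> bool" where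
  "k_smooth_on 0 S f \<longleftrightarrow> continuous_on S f"
| "k_smooth_on (Suc k) S f \<longleftrightarrow>
     (\<forall>x\<in>S. f differentiable (at x)) \<and>
     (\<forall>v. k_smooth_on k S (\<lambda>x. frechet_derivative f (at x) v))"

definition smooth_on :: "'a::real_normed_vector set \<Rightarrow> ('a \<Rightarrow> 'b::real_normed_vector) \<Rightarrow> bool" where
  "smooth_on S f \<longleftrightarrow> (\<forall>k. k_smooth_on k S f)"

section \<open>Smooth manifolds\<close>

text \<open>A chart is a pair of its domain and a map, whose values outside the domain are irrelevant.
  The underlying set of a manifold is a whole topological type.\<close>

type_synonym ('m, 'e) chart = "'m set \<times> ('m \<Rightarrow> 'e)"

abbreviation cdom :: "('m, 'e) chart \<Rightarrow> 'm set" where "cdom c \<equiv> fst c"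
abbreviation cmap :: "('m, 'e) chart \<Rightarrow> 'm \<Rightarrow> 'e" where "cmap c \<equiv> snd c"
abbreviation cinv :: "('m, 'e) chart \<Rightarrow> 'e \<Rightarrow> 'm" where "cinv c \<equiv> inv_into (cdom c) (cmap c)"

definition is_chart :: "('m::topological_space, 'e::real_normed_vector) chart \<Rightarrow> bool" where
  "is_chart c \<longleftrightarrow> open (cdom c) \<and> open (cmap c ` cdom c) \<and>
     homeomorphism (cdom c) (cmap c ` cdom c) (cmap c) (cinv c)"

text \<open>The atlas need not be maximal.\<close>

definition smooth_manifold ::
    "('m::{t2_space,second_countable_topology}, 'e::{real_inner,heine_borel}) chart set \<Rightarrow> bool" where
  "smooth_manifold A \<longleftrightarrow>
     finite_dimensional TYPE('e) \<and>
     (\<forall>c\<in>A. is_chart c) \<and>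
     (\<Union>c\<in>A. cdom c) = UNIV \<and>
     (\<forall>c\<in>A. \<forall>d\<in>A. smooth_on (cmap c ` (cdom c \<inter> cdom d)) (cmap d \<circ> cinv c))"

definition vec_atlas :: "('e::real_normed_vector, 'e) chart set" where
  "vec_atlas = {(UNIV, id)}"

definition prod_atlas :: "('m, 'e) chart set \<Rightarrow> ('n, 'f) chart set \<Rightarrow> ('m \<times> 'n, 'e \<times> 'f) chart set" where
  "prod_atlas A B = {(cdom c \<times> cdom d, map_prod (cmap c) (cmap d)) | c d. c \<in> A \<and> d \<in> B}"

definition smooth_map ::
    "('m::topological_space, 'e::real_normed_vector) chart set \<Rightarrow>
     ('n::topological_space, 'f::real_normed_vector) chart set \<Rightarrow> ('m \<Rightarrow> 'n) \<Rightarrow> bool" where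
  "smooth_map A B h \<longleftrightarrow> continuous_on UNIV h \<and>
     (\<forall>c\<in>A. \<forall>d\<in>B. smooth_on (cmap c ` (cdom c \<inter> h -` cdom d)) (cmap d \<circ> h \<circ> cinv c))"

section \<open>Tangent vectors\<close>

text \<open>A tangent vector at \<open>p\<close> is the family of its coordinate representations in the charts around
  \<open>p\<close>, related by the derivatives of the transition maps; it is set to 0 on all other index values.
  The vector space operations are pointwise.\<close>

definition tangent_space ::
    "('m, 'e::real_normed_vector) chart set \<Rightarrow> 'm \<Rightarrow> (('m, 'e) chart \<Rightarrow> 'e) set" where
  "tangent_space A p = {v.
     (\<forall>c\<in>A. \<forall>d\<in>A. p \<in> cdom c \<inter> cdom d \<longrightarrow>
        v d = frechet_derivative (cmap d \<circ> cinv c) (at (cmap c p)) (v c)) \<and>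
     (\<forall>c. \<not> (c \<in> A \<and> p \<in> cdom c) \<longrightarrow> v c = 0)}"

text \<open>An arbitrary chart around \<open>p\<close>; what is defined with it below does not depend on the choice.\<close>

definition chart_at :: "('m, 'e) chart set \<Rightarrow> 'm \<Rightarrow> ('m, 'e) chart" where
  "chart_at A p = (SOME c. c \<in> A \<and> p \<in> cdom c)"

definition differential ::
    "('m, 'e::real_normed_vector) chart set \<Rightarrow> ('m \<Rightarrow> 'b::real_normed_vector) \<Rightarrow> 'm \<Rightarrow>
     (('m, 'e) chart \<Rightarrow> 'e) \<Rightarrow> 'b" where
  "differential A h p v =
     (let c = chart_at A p in frechet_derivative (h \<circ> cinv c) (at (cmap c p)) (v c))"

definition tangent_map ::
    "('m, 'e::real_normed_vector) chart set \<Rightarrow> ('n, 'f::real_normed_vector) chart set \<Rightarrow>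
     ('m \<Rightarrow> 'n) \<Rightarrow> 'm \<Rightarrow> (('m, 'e) chart \<Rightarrow> 'e) \<Rightarrow> (('n, 'f) chart \<Rightarrow> 'f)" where
  "tangent_map A B h p v =
     (\<lambda>d. if d \<in> B \<and> h p \<in> cdom d then differential A (cmap d \<circ> h) p v else 0)"

definition critical_point ::
    "('m, 'e::real_normed_vector) chart set \<Rightarrow> ('m \<Rightarrow> real) \<Rightarrow> 'm \<Rightarrow> bool" where
  "critical_point A f p \<longleftrightarrow> (\<forall>v\<in>tangent_space A p. differential A f p v = 0)"

text \<open>Independent of the chart only at a critical point.\<close>

definition hessian ::
    "('m, 'e::real_normed_vector) chart set \<Rightarrow> ('m \<Rightarrow> real) \<Rightarrow> 'm \<Rightarrow>
     (('m, 'e) chart \<Rightarrow> 'e) \<Rightarrow> (('m, 'e) chart \<Rightarrow> 'e) \<Rightarrow> real" where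
  "hessian A f p v w =
     (let c = chart_at A p in
        frechet_derivative (\<lambda>x. frechet_derivative (f \<circ> cinv c) (at x) (w c)) (at (cmap c p)) (v c))"

definition pos_semidefinite_on :: "'v set \<Rightarrow> ('v \<Rightarrow> 'v \<Rightarrow> real) \<Rightarrow> bool" where
  "pos_semidefinite_on T b \<longleftrightarrow> (\<forall>v\<in>T. 0 \<le> b v v)"

definition form_kernel :: "'v set \<Rightarrow> ('v \<Rightarrow> 'v \<Rightarrow> real) \<Rightarrow> 'v set" where
  "form_kernel T b = {v\<in>T. \<forall>w\<in>T. b v w = 0}"

section \<open>Vector fields, trajectories and flows\<close>

definition smooth_vector_field ::
    "('m, 'e::real_normed_vector) chart set \<Rightarrow> ('m \<Rightarrow> ('m, 'e) chart \<Rightarrow> 'e) \<Rightarrow> bool" where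
  "smooth_vector_field A X \<longleftrightarrow>
     (\<forall>p. X p \<in> tangent_space A p) \<and>
     (\<forall>c\<in>A. smooth_on (cmap c ` cdom c) (\<lambda>x. X (cinv c x) c))"

definition has_velocity ::
    "('m::topological_space, 'e::real_normed_vector) chart set \<Rightarrow> (real \<Rightarrow> 'm) \<Rightarrow>
     (('m, 'e) chart \<Rightarrow> 'e) \<Rightarrow> real \<Rightarrow> bool" where
  "has_velocity A \<gamma> v t \<longleftrightarrow> v \<in> tangent_space A (\<gamma> t) \<and> isCont \<gamma> t \<and>
     (\<forall>c\<in>A. \<gamma> t \<in> cdom c \<longrightarrow> ((cmap c \<circ> \<gamma>) has_vector_derivative v c) (at t))"

definition trajectory ::
    "('m::topological_space, 'e::real_normed_vector) chart set \<Rightarrow>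
     ('m \<Rightarrow> ('m, 'e) chart \<Rightarrow> 'e) \<Rightarrow> (real \<Rightarrow> 'm) \<Rightarrow> bool" where
  "trajectory A X \<gamma> \<longleftrightarrow> (\<forall>t. has_velocity A \<gamma> (X (\<gamma> t)) t)"

definition flow_of ::
    "('m::topological_space, 'e::real_normed_vector) chart set \<Rightarrow>
     ('m \<Rightarrow> ('m, 'e) chart \<Rightarrow> 'e) \<Rightarrow> (real \<Rightarrow> 'm \<Rightarrow> 'm) \<Rightarrow> bool" where
  "flow_of A X F \<longleftrightarrow> (\<forall>x. F 0 x = x \<and> trajectory A X (\<lambda>t. F t x))"

section \<open>Lie groups and their actions\<close>

definition lie_group ::
    "('g::{t2_space,second_countable_topology}, 'h::{real_inner,heine_borel}) chart set \<Rightarrow>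
     ('g, 'r) monoid_scheme \<Rightarrow> bool" where
  "lie_group B G \<longleftrightarrow> group G \<and> carrier G = UNIV \<and> smooth_manifold B \<and>
     smooth_map (prod_atlas B B) B (\<lambda>(g, h). g \<otimes>\<^bsub>G\<^esub> h) \<and>
     smooth_map B B (\<lambda>g. inv\<^bsub>G\<^esub> g)"

definition lie_algebra ::
    "('g, 'h::real_normed_vector) chart set \<Rightarrow> ('g, 'r) monoid_scheme \<Rightarrow> (('g, 'h) chart \<Rightarrow> 'h) set" where
  "lie_algebra B G = tangent_space B \<one>\<^bsub>G\<^esub>"

definition one_parameter_subgroup ::
    "('g::topological_space, 'h::real_normed_vector) chart set \<Rightarrow> ('g, 'r) monoid_scheme \<Rightarrow>
     (real \<Rightarrow> 'g) \<Rightarrow> bool" where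
  "one_parameter_subgroup B G \<gamma> \<longleftrightarrow> smooth_map vec_atlas B \<gamma> \<and>
     (\<forall>s t. \<gamma> (s + t) = \<gamma> s \<otimes>\<^bsub>G\<^esub> \<gamma> t)"

text \<open>The one-parameter subgroup \<open>t \<mapsto> exp (t \<xi>)\<close> of \<open>\<xi>\<close>.\<close>

definition exp_curve ::
    "('g::topological_space, 'h::real_normed_vector) chart set \<Rightarrow> ('g, 'r) monoid_scheme \<Rightarrow>
     (('g, 'h) chart \<Rightarrow> 'h) \<Rightarrow> (real \<Rightarrow> 'g) \<Rightarrow> bool" where
  "exp_curve B G \<xi> \<gamma> \<longleftrightarrow> one_parameter_subgroup B G \<gamma> \<and> has_velocity B \<gamma> \<xi> 0"

definition lie_exp ::
    "('g::topological_space, 'h::real_normed_vector) chart set \<Rightarrow> ('g, 'r) monoid_scheme \<Rightarrow>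
     (('g, 'h) chart \<Rightarrow> 'h) \<Rightarrow> 'g" where
  "lie_exp B G \<xi> = (THE \<gamma>. exp_curve B G \<xi> \<gamma>) 1"

definition smooth_action ::
    "('g::{t2_space,second_countable_topology}, 'h::{real_inner,heine_borel}) chart set \<Rightarrow>
     ('g, 'r) monoid_scheme \<Rightarrow>
     ('m::{t2_space,second_countable_topology}, 'e::{real_inner,heine_borel}) chart set \<Rightarrow>
     ('g \<Rightarrow> 'm \<Rightarrow> 'm) \<Rightarrow> bool" where
  "smooth_action B G A \<Phi> \<longleftrightarrow> group_action G UNIV \<Phi> \<and>
     smooth_map (prod_atlas B A) A (\<lambda>(g, x). \<Phi> g x)"

definition proper_action :: "('g::topological_space \<Rightarrow> 'm::topological_space \<Rightarrow> 'm) \<Rightarrow> bool" where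
  "proper_action \<Phi> \<longleftrightarrow> proper_map euclidean euclidean (\<lambda>(g, x). (\<Phi> g x, x))"

definition equivariant_field ::
    "('m, 'e::real_normed_vector) chart set \<Rightarrow> ('g, 'r) monoid_scheme \<Rightarrow> ('g \<Rightarrow> 'm \<Rightarrow> 'm) \<Rightarrow>
     ('m \<Rightarrow> ('m, 'e) chart \<Rightarrow> 'e) \<Rightarrow> bool" where
  "equivariant_field A G \<Phi> X \<longleftrightarrow>
     (\<forall>g\<in>carrier G. \<forall>x. X (\<Phi> g x) = tangent_map A A (\<Phi> g) x (X x))"

definition invariant_function :: "('g, 'r) monoid_scheme \<Rightarrow> ('g \<Rightarrow> 'm \<Rightarrow> 'm) \<Rightarrow> ('m \<Rightarrow> real) \<Rightarrow> bool" where
  "invariant_function G \<Phi> f \<longleftrightarrow> (\<forall>g\<in>carrier G. \<forall>x. f (\<Phi> g x) = f x)"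

text \<open>\<open>v\<close> is the value at \<open>x\<close> of the infinitesimal generator of \<open>\<xi>\<close>, i.e. the velocity at
  \<open>t = 0\<close> of \<open>exp (t \<xi>) \<cdot> x\<close>.\<close>

definition inf_generator_at ::
    "('g::topological_space, 'h::real_normed_vector) chart set \<Rightarrow> ('g, 'r) monoid_scheme \<Rightarrow>
     ('m::topological_space, 'e::real_normed_vector) chart set \<Rightarrow> ('g \<Rightarrow> 'm \<Rightarrow> 'm) \<Rightarrow>
     (('g, 'h) chart \<Rightarrow> 'h) \<Rightarrow> 'm \<Rightarrow> (('m, 'e) chart \<Rightarrow> 'e) \<Rightarrow> bool" where
  "inf_generator_at B G A \<Phi> \<xi> x v \<longleftrightarrow>
     (\<exists>\<gamma>. exp_curve B G \<xi> \<gamma> \<and> has_velocity A (\<lambda>t. \<Phi> (\<gamma> t) x) v 0)"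

definition orbit_tangent_space ::
    "('g::topological_space, 'h::real_normed_vector) chart set \<Rightarrow> ('g, 'r) monoid_scheme \<Rightarrow>
     ('m::topological_space, 'e::real_normed_vector) chart set \<Rightarrow> ('g \<Rightarrow> 'm \<Rightarrow> 'm) \<Rightarrow> 'm \<Rightarrow>
     (('m, 'e) chart \<Rightarrow> 'e) set" where
  "orbit_tangent_space B G A \<Phi> x = {v. \<exists>\<xi>\<in>lie_algebra B G. inf_generator_at B G A \<Phi> \<xi> x v}"

section \<open>Relative equilibria and stability\<close>

definition relative_equilibrium ::
    "('g::topological_space, 'h::real_normed_vector) chart set \<Rightarrow> ('g, 'r) monoid_scheme \<Rightarrow>
     ('m::topological_space, 'e::real_normed_vector) chart set \<Rightarrow> ('g \<Rightarrow> 'm \<Rightarrow> 'm) \<Rightarrow>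
     ('m \<Rightarrow> ('m, 'e) chart \<Rightarrow> 'e) \<Rightarrow> 'm \<Rightarrow> bool" where
  "relative_equilibrium B G A \<Phi> X m \<longleftrightarrow>
     (\<exists>\<xi>\<in>lie_algebra B G. trajectory A X (\<lambda>t. \<Phi> (lie_exp B G (\<lambda>c. t *\<^sub>R \<xi> c)) m))"

text \<open>Stability modulo a subgroup \<open>H\<close>, given by its underlying set.\<close>

definition stable_modulo ::
    "'g set \<Rightarrow> ('g \<Rightarrow> 'm::topological_space \<Rightarrow> 'm) \<Rightarrow> (real \<Rightarrow> 'm \<Rightarrow> 'm) \<Rightarrow> 'm \<Rightarrow> bool" where
  "stable_modulo H \<Phi> F m \<longleftrightarrow>
     (\<forall>U. open U \<and> (\<forall>g\<in>H. \<Phi> g ` U \<subseteq> U) \<and> (\<lambda>g. \<Phi> g m) ` H \<subseteq> U \<longrightarrow>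
        (\<exists>V. open V \<and> m \<in> V \<and> V \<subseteq> U \<and> (\<forall>t\<ge>0. F t ` V \<subseteq> U)))"

end

theory Submission
  imports Defs
begin

text \<open>Because \<open>f\<close> stays below any prescribed \<open>\<epsilon> > 0\<close> along trajectories that start near \<open>m\<close>, a
  continuous trajectory that starts in an open set \<open>W\<close> cannot leave it if \<open>f \<ge> \<epsilon>\<close> on the frontier of
  \<open>W\<close>. Stability therefore follows once every invariant neighborhood \<open>U\<close> of the orbit contains such
  a \<open>W\<close> around \<open>m\<close> (\<open>stable_modulo_if_barriers\<close>, \<open>invariant_barrier\<close>).

  For \<open>W\<close> take the \<open>G\<close>-saturation of a chart ball of small radius \<open>r\<close> around \<open>m\<close>. By properness
  the saturation of the closed ball is closed, so a frontier point of \<open>W\<close> is \<open>g \<cdot> x\<close> with \<open>x\<close> on the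
  sphere of radius \<open>r\<close> and the orbit of \<open>x\<close> disjoint from the open ball. Among the points of its
  orbit inside the chart, \<open>x\<close> is then as close to \<open>m\<close> as possible, and the first-order condition says
  that in coordinates \<open>h = x - m\<close> is orthogonal to the values at \<open>x\<close> of the infinitesimal generators
  (\<open>orbit_minimizer_orthogonal\<close>). These depend continuously on \<open>x\<close> and at \<open>m\<close> they include a spanning
  set of the kernel of the Hessian; hence \<open>h\<close> is almost orthogonal to this kernel. On vectors almost
  orthogonal to its kernel the positive semi-definite Hessian is coercive, and the second-order Taylor
  formula gives \<open>f x \<ge> C |h|\<^sup>2 = C r\<^sup>2\<close> (\<open>quadratic_growth_transverse\<close>). By invariance the same
  bound holds at \<open>g \<cdot> x\<close>.

  Minimising the distance over the orbit replaces the slice theorem: neither a tubular neighborhood nor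
  the inverse function theorem is needed.\<close>

section \<open>Finite-dimensional preliminaries\<close>

lemma finite_dimensional_orthonormal_basis:
  assumes "finite_dimensional TYPE('e::real_inner)"
  obtains C :: "'e::real_inner set" where "finite C" "\<And>b. b \<in> C \<Longrightarrow> norm b = 1"
    "\<And>x. x = (\<Sum>b\<in>C. (x \<bullet> b) *\<^sub>R b)"
proof -
  obtain S :: "'e set" where S: "finite S" "span S = UNIV"
    using assms unfolding finite_dimensional_def by blast
  obtain T :: "'e set" where T: "finite T" "span T = UNIV" "pairwise orthogonal T"
    using basis_orthogonal[OF S(1)] S(2) by metis
  define C where "C = (\<lambda>b. b /\<^sub>R norm b) ` (T - {0})"
  have fin: "finite C" using T(1) by (simp add: C_def)
  have one: "norm b = 1" if "b \<in> C" for b using that by (auto simp: C_def field_simps split: if_splits)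
  have orth: "a \<bullet> b = 0" if "a \<in> C" "b \<in> C" "a \<noteq> b" for a b
    using that T(3) by (auto simp: C_def pairwise_def orthogonal_def) metis
  have "x = (\<Sum>b\<in>C. (x \<bullet> b) *\<^sub>R b)" for x
  proof -
    have "x \<in> span T" using T(2) by simp
    then show ?thesis
    proof (induction rule: span_induct)
      case base
      show ?case
        by (auto simp: subspace_def inner_add_left scaleR_add_left sum.distrib scaleR_sum_right)
          (metis (mono_tags, lifting) scaleR_scaleR scaleR_sum_right sum.cong)
    next
      case (step x)
      show ?case
      proof (cases "x = 0")
        case False
        define e where "e = x /\<^sub>R norm x"
        have e: "e \<in> C" using step False by (auto simp: C_def e_def)
        have xe: "x = norm x *\<^sub>R e" using False by (simp add: e_def)
        have "(\<Sum>b\<in>C. (e \<bullet> b) *\<^sub>R b) = (\<Sum>b\<in>C. if b = e then e else 0)"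
          using orth e one[OF e] by (intro sum.cong) (auto simp: dot_square_norm)
        also have "\<dots> = e" using fin e by simp
        finally have "(\<Sum>b\<in>C. (e \<bullet> b) *\<^sub>R b) = e" .
        then have "norm x *\<^sub>R e = norm x *\<^sub>R (\<Sum>b\<in>C. (e \<bullet> b) *\<^sub>R b)" by simp
        also have "\<dots> = (\<Sum>b\<in>C. ((norm x *\<^sub>R e) \<bullet> b) *\<^sub>R b)" by (simp add: scaleR_sum_right)
        finally show ?thesis unfolding xe[symmetric] .
      qed simp
    qed
  qed
  with fin one show thesis by (rule that)
qed

lemma add_mem_ball_iff: "a + k \<in> ball a e \<longleftrightarrow> norm k < e" for a :: "'a::real_normed_vector"
  by (simp add: mem_ball dist_norm)

lemma derivative_along_line:
  fixes f :: "'a::real_normed_vector \<Rightarrow> real"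
  assumes "(f has_derivative L) (at (a + s *\<^sub>R v))"
  shows "((\<lambda>s. f (a + s *\<^sub>R v)) has_real_derivative L v) (at s)"
proof -
  have "((\<lambda>s. a + s *\<^sub>R v) has_derivative (\<lambda>h. h *\<^sub>R v)) (at s)"
    by (auto intro!: derivative_eq_intros)
  then have "((\<lambda>s. f (a + s *\<^sub>R v)) has_derivative (\<lambda>h. L (h *\<^sub>R v))) (at s)"
    using assms by (rule has_derivative_compose)
  moreover have "L (h *\<^sub>R v) = L v * h" for h
    using linear_cmul[OF has_derivative_linear[OF assms]] by simp
  ultimately show ?thesis by (simp add: has_field_derivative_def)
qed

lemma has_derivative_at_error:
  assumes "(g has_derivative L) (at a)" "0 < \<eta>"
  obtains \<delta> where "0 < \<delta>" "\<And>k. norm k < \<delta> \<Longrightarrow> norm (g (a + k) - g a - L k) \<le> \<eta> * norm k"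
proof -
  obtain d where "d > 0" "\<And>y. norm (y - a) < d \<Longrightarrow> norm (g y - g a - L (y - a)) \<le> \<eta> * norm (y - a)"
    using assms unfolding has_derivative_at_alt by blast
  then show thesis
    using that[of d] by (metis add_diff_cancel_left')
qed

section \<open>Symmetry of the second derivative\<close>

text \<open>The second mixed difference of \<open>f\<close> along \<open>t v\<close> and \<open>t w\<close> is \<open>t\<^sup>2 L w + o(t\<^sup>2)\<close>, where \<open>L\<close> is the
  derivative at \<open>a\<close> of the directional derivative along \<open>v\<close>. As the mixed difference is symmetric
  in \<open>v\<close> and \<open>w\<close>, so is the second derivative. Differentiability of the first derivatives at the
  single point \<open>a\<close> suffices.\<close>

lemma mixed_difference_estimate:
  fixes f :: "'a::real_normed_vector \<Rightarrow> real"
  assumes S: "open S" "a \<in> S"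
    and df: "\<And>x. x \<in> S \<Longrightarrow> (f has_derivative D x) (at x)"
    and ddf: "((\<lambda>x. D x v) has_derivative L) (at a)"
    and \<eta>: "0 < \<eta>"
  shows "\<exists>\<tau>>0. \<forall>t. 0 < t \<and> t < \<tau> \<longrightarrow>
    \<bar>f (a + t *\<^sub>R v + t *\<^sub>R w) - f (a + t *\<^sub>R v) - f (a + t *\<^sub>R w) + f a - t\<^sup>2 * L w\<bar> \<le> \<eta> * t\<^sup>2"
proof -
  define N where "N = norm v + norm w + 1"
  have N: "N > 0" "norm v \<le> N" "norm w \<le> N" "norm v + norm w \<le> N"
    by (simp_all add: N_def add_nonneg_pos)
  obtain d where d: "d > 0" "\<And>k. norm k < d \<Longrightarrow> \<bar>D (a + k) v - D a v - L k\<bar> \<le> \<eta> / (2 * N) * norm k"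
    using has_derivative_at_error[OF ddf, of "\<eta> / (2 * N)"] \<eta> N by auto
  obtain e where e: "e > 0" "ball a e \<subseteq> S" using S openE by blast
  interpret L: bounded_linear L using ddf by (rule has_derivative_bounded_linear)
  show ?thesis
  proof (intro exI[of _ "min d e / N"] conjI allI impI)
    show "min d e / N > 0" using d e N by simp
    fix t assume "0 < t \<and> t < min d e / N"
    then have t: "0 < t" "t * N < d" "t * N < e" using N by (auto simp: field_simps)
    have nrm: "norm (s *\<^sub>R v + r *\<^sub>R w) \<le> t * N" if "0 \<le> s" "s \<le> t" "0 \<le> r" "r \<le> t" for s r
    proof -
      have "norm (s *\<^sub>R v + r *\<^sub>R w) \<le> s * norm v + r * norm w"
        using norm_triangle_ineq[of "s *\<^sub>R v" "r *\<^sub>R w"] that by simp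
      also have "\<dots> \<le> t * norm v + t * norm w"
        using that by (intro add_mono mult_right_mono) auto
      also have "\<dots> \<le> t * N" using mult_left_mono[OF N(4), of t] t(1) by (simp add: distrib_left)
      finally show ?thesis .
    qed
    define g where "g s = f (a + t *\<^sub>R w + s *\<^sub>R v) - f (a + 0 *\<^sub>R w + s *\<^sub>R v)" for s
    define g' where "g' s = D (a + t *\<^sub>R w + s *\<^sub>R v) v - D (a + 0 *\<^sub>R w + s *\<^sub>R v) v" for s
    have line: "((\<lambda>s. f (a + r *\<^sub>R w + s *\<^sub>R v)) has_real_derivative D (a + r *\<^sub>R w + s *\<^sub>R v) v) (at s)"
      if "0 \<le> s" "s \<le> t" "0 \<le> r" "r \<le> t" for s r
    proof -
      have "a + (s *\<^sub>R v + r *\<^sub>R w) \<in> ball a e"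
        unfolding add_mem_ball_iff using nrm[OF that] t(3) by simp
      then have "a + r *\<^sub>R w + s *\<^sub>R v \<in> S" using e(2) by (auto simp: add_ac)
      then show ?thesis by (rule derivative_along_line[OF df])
    qed
    have "\<exists>z>0. z < t \<and> g t - g 0 = (t - 0) * g' z"
      unfolding g_def g'_def
      by (rule MVT2) (use t line[of _ t] line[of _ 0] in \<open>auto intro!: DERIV_diff simp del: scaleR_zero_left\<close>)
    then obtain z where z: "0 < z" "z < t" "g t - g 0 = t * g' z" by auto
    have est: "\<bar>D (a + r *\<^sub>R w + z *\<^sub>R v) v - D a v - L (z *\<^sub>R v + r *\<^sub>R w)\<bar> \<le> \<eta> / 2 * t"
      if "0 \<le> r" "r \<le> t" for r
    proof -
      have n: "norm (z *\<^sub>R v + r *\<^sub>R w) \<le> t * N" using nrm z that by simp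
      then have "\<bar>D (a + r *\<^sub>R w + z *\<^sub>R v) v - D a v - L (z *\<^sub>R v + r *\<^sub>R w)\<bar>
          \<le> \<eta> / (2 * N) * norm (z *\<^sub>R v + r *\<^sub>R w)"
        using d(2)[of "z *\<^sub>R v + r *\<^sub>R w"] t(2) by (simp add: add_ac)
      also have "\<dots> \<le> \<eta> / (2 * N) * (t * N)"
        using n \<eta> N by (intro mult_left_mono) auto
      also have "\<dots> = \<eta> / 2 * t" using N by simp
      finally show ?thesis .
    qed
    have "L (z *\<^sub>R v + t *\<^sub>R w) - L (z *\<^sub>R v + 0 *\<^sub>R w) = t * L w"
      by (simp add: L.add L.scaleR)
    then have "\<bar>g' z - t * L w\<bar> \<le> \<eta> * t"
      using est[OF _ order_refl] est[OF order_refl] t(1) unfolding g'_def by linarith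
    then have "\<bar>t * (g' z - t * L w)\<bar> \<le> t * (\<eta> * t)"
      using t(1) by (simp add: abs_mult)
    moreover have "f (a + t *\<^sub>R v + t *\<^sub>R w) - f (a + t *\<^sub>R v) - f (a + t *\<^sub>R w) + f a - t\<^sup>2 * L w
        = t * (g' z - t * L w)"
      using z(3) by (simp add: g_def algebra_simps power2_eq_square)
    ultimately show "\<bar>f (a + t *\<^sub>R v + t *\<^sub>R w) - f (a + t *\<^sub>R v) - f (a + t *\<^sub>R w) + f a - t\<^sup>2 * L w\<bar> \<le> \<eta> * t\<^sup>2"
      by (simp add: power2_eq_square mult_ac)
  qed
qed

lemma second_derivative_symmetric:
  fixes f :: "'a::real_normed_vector \<Rightarrow> real"
  assumes S: "open S" "a \<in> S"
    and df: "\<And>x. x \<in> S \<Longrightarrow> (f has_derivative D x) (at x)"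
    and ddf: "\<And>w. ((\<lambda>x. D x w) has_derivative (\<lambda>v. H v w)) (at a)"
  shows "H v w = H w v"
proof -
  have "\<bar>H v w - H w v\<bar> \<le> \<epsilon>" if \<epsilon>: "\<epsilon> > 0" for \<epsilon>
  proof -
    have \<epsilon>2: "\<epsilon> / 2 > 0" using \<epsilon> by simp
    obtain t1 where t1: "t1 > 0" "\<And>t. 0 < t \<and> t < t1 \<Longrightarrow>
      \<bar>f (a + t *\<^sub>R v + t *\<^sub>R w) - f (a + t *\<^sub>R v) - f (a + t *\<^sub>R w) + f a - t\<^sup>2 * H w v\<bar> \<le> \<epsilon> / 2 * t\<^sup>2"
      using mixed_difference_estimate[OF S df ddf \<epsilon>2, of v w] by blast
    obtain t2 where t2: "t2 > 0" "\<And>t. 0 < t \<and> t < t2 \<Longrightarrow>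
      \<bar>f (a + t *\<^sub>R w + t *\<^sub>R v) - f (a + t *\<^sub>R w) - f (a + t *\<^sub>R v) + f a - t\<^sup>2 * H v w\<bar> \<le> \<epsilon> / 2 * t\<^sup>2"
      using mixed_difference_estimate[OF S df ddf \<epsilon>2, of w v] by blast
    define t where "t = min t1 t2 / 2"
    have t: "0 < t" "t < t1" "t < t2" using t1(1) t2(1) by (auto simp: t_def)
    have "a + t *\<^sub>R w + t *\<^sub>R v = a + t *\<^sub>R v + t *\<^sub>R w" by (simp add: add_ac)
    then have "\<bar>t\<^sup>2 * H v w - t\<^sup>2 * H w v\<bar> \<le> \<epsilon> / 2 * t\<^sup>2 + \<epsilon> / 2 * t\<^sup>2"
      using t1(2)[OF conjI[OF t(1,2)]] t2(2)[OF conjI[OF t(1,3)]] by (simp only:)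
    then have "t\<^sup>2 * \<bar>H v w - H w v\<bar> \<le> t\<^sup>2 * \<epsilon>"
      by (simp add: abs_mult mult.commute[of _ \<epsilon>] flip: right_diff_distrib)
    then show ?thesis using t(1) by simp
  qed
  then have "\<bar>H v w - H w v\<bar> \<le> 0" by (rule field_le_epsilon[of _ 0, simplified])
  then show ?thesis by simp
qed

text \<open>Symmetry matters here: it identifies the null vectors of the quadratic form with the kernel of
  the bilinear form.\<close>

lemma psd_symmetric_null:
  fixes H :: "'a::real_vector \<Rightarrow> 'a \<Rightarrow> real"
  assumes lin: "\<And>w. linear (\<lambda>v. H v w)" and sym: "\<And>v w. H v w = H w v"
    and psd: "\<And>v. 0 \<le> H v v" and null: "H p p = 0"
  shows "H p w = 0"
proof (rule ccontr)
  assume nz: "H p w \<noteq> 0"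
  \<comment> \<open>The form takes the value \<open>2 s H(p, w) + H(w, w)\<close> at \<open>s p + w\<close>, and this \<open>s\<close> makes it \<open>-1\<close>.\<close>
  define s where "s = - (H w w + 1) / (2 * H p w)"
  have "H (s *\<^sub>R p + w) (s *\<^sub>R p + w) = s * H p (s *\<^sub>R p + w) + H w (s *\<^sub>R p + w)"
    using linear_add[OF lin] linear_cmul[OF lin] by simp
  also have "\<dots> = s * H (s *\<^sub>R p + w) p + H (s *\<^sub>R p + w) w" by (metis sym)
  also have "\<dots> = s * (s * H p p + H w p) + (s * H p w + H w w)"
    using linear_add[OF lin] linear_cmul[OF lin] by simp
  also have "\<dots> = 2 * s * H p w + H w w"
    using null sym[of w p] by simp
  also have "\<dots> = -1" using nz by (simp add: s_def field_simps)
  finally show False using psd[of "s *\<^sub>R p + w"] by simp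
qed

section \<open>Growth of a function transversally to the kernel of its Hessian\<close>

text \<open>In this context \<open>f\<close> is differentiable on the open set \<open>S\<close> with derivative \<open>D x\<close>, the point \<open>a\<close> of
  \<open>S\<close> is critical, and \<open>H\<close> is the Hessian at \<open>a\<close>, its first argument being the direction of the
  second differentiation.\<close>

context
  fixes f :: "'e::{real_inner,heine_borel} \<Rightarrow> real" and S a D H
  assumes fd: "finite_dimensional TYPE('e)"
    and S: "open S" "a \<in> S"
    and df: "\<And>x. x \<in> S \<Longrightarrow> (f has_derivative D x) (at x)"
    and ddf: "\<And>w. ((\<lambda>x. D x w) has_derivative (\<lambda>v. H v w)) (at a)"
    and crit: "\<And>w. D a w = 0"
begin

lemma hessian_bilinear: "linear (\<lambda>v. H v w)" "linear (\<lambda>w. H v w)"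
proof -
  show *: "linear (\<lambda>v. H v w)" for w
    using ddf[of w] by (rule has_derivative_linear)
  have "(\<lambda>w. H v w) = (\<lambda>w. H w v)"
    using second_derivative_symmetric[OF S df ddf] by blast
  with * show "linear (\<lambda>w. H v w)" by simp
qed

lemma gradient_estimate:
  assumes "0 < \<eta>"
  obtains \<delta> where "0 < \<delta>" "ball a \<delta> \<subseteq> S"
    "\<And>k w. norm k < \<delta> \<Longrightarrow> \<bar>D (a + k) w - H k w\<bar> \<le> \<eta> * norm k * norm w"
proof -
  obtain C :: "'e set" where C: "finite C" "\<And>b. b \<in> C \<Longrightarrow> norm b = 1"
    "\<And>x. x = (\<Sum>b\<in>C. (x \<bullet> b) *\<^sub>R b)"
    using finite_dimensional_orthonormal_basis[OF fd] by blast
  define \<zeta> where "\<zeta> = \<eta> / (card C + 1)"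
  have \<zeta>: "\<zeta> > 0" "card C * \<zeta> \<le> \<eta>" using assms by (auto simp: \<zeta>_def field_simps)
  have "\<forall>b. \<exists>\<delta>>0. \<forall>k. norm k < \<delta> \<longrightarrow> norm (D (a + k) b - D a b - H k b) \<le> \<zeta> * norm k"
    by (metis has_derivative_at_error[OF ddf \<zeta>(1)])
  then obtain d where d: "\<And>b. d b > 0"
    "\<And>b k. norm k < d b \<Longrightarrow> norm (D (a + k) b - D a b - H k b) \<le> \<zeta> * norm k" by metis
  obtain e where e: "e > 0" "ball a e \<subseteq> S" using S openE by blast
  define \<delta> where "\<delta> = Min (insert e (d ` C))"
  have \<delta>: "\<delta> > 0" "\<delta> \<le> e" "\<And>b. b \<in> C \<Longrightarrow> \<delta> \<le> d b"
    using C(1) d(1) e(1) by (auto simp: \<delta>_def)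
  show thesis
  proof (rule that)
    show "\<delta> > 0" by (rule \<delta>)
    show "ball a \<delta> \<subseteq> S" using \<delta>(2) e(2) by (meson subset_ball subset_trans)
    fix k w :: 'e assume k: "norm k < \<delta>"
    then have "a + k \<in> S" using \<delta>(2) e(2) add_mem_ball_iff by (meson order_less_le_trans subsetD)
    then have linD: "linear (D (a + k))" using df has_derivative_linear by blast
    define E where "E w = D (a + k) w - H k w" for w
    have linE: "linear E"
      unfolding E_def by (intro linear_compose_sub linD hessian_bilinear)
    have "E w = E (\<Sum>b\<in>C. (w \<bullet> b) *\<^sub>R b)" by (rule arg_cong[OF C(3)])
    also have "\<dots> = (\<Sum>b\<in>C. (w \<bullet> b) * E b)"
      by (simp add: linear_sum[OF linE] linear_cmul[OF linE])
    finally have "D (a + k) w - H k w = (\<Sum>b\<in>C. (w \<bullet> b) * (D (a + k) b - H k b))"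
      by (simp add: E_def)
    also have "\<bar>\<dots>\<bar> \<le> (\<Sum>b\<in>C. norm w * (\<zeta> * norm k))"
    proof (rule order_trans[OF sum_abs], rule sum_mono)
      fix b assume b: "b \<in> C"
      have "\<bar>w \<bullet> b\<bar> \<le> norm w" using Cauchy_Schwarz_ineq2[of w b] C(2)[OF b] by simp
      moreover have "\<bar>D (a + k) b - H k b\<bar> \<le> \<zeta> * norm k"
        using d(2)[of k b] k \<delta>(3)[OF b] by (simp add: crit)
      ultimately show "\<bar>(w \<bullet> b) * (D (a + k) b - H k b)\<bar> \<le> norm w * (\<zeta> * norm k)"
        unfolding abs_mult by (intro mult_mono) auto
    qed
    also have "\<dots> = (card C * \<zeta>) * (norm k * norm w)" by simp
    also have "\<dots> \<le> \<eta> * (norm k * norm w)" using \<zeta>(2) by (intro mult_right_mono) auto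
    finally show "\<bar>D (a + k) w - H k w\<bar> \<le> \<eta> * norm k * norm w" by (simp add: mult.assoc)
  qed
qed

lemma second_order_taylor:
  assumes \<eta>: "0 < \<eta>"
  obtains \<delta> where "0 < \<delta>" "\<And>h. norm h < \<delta> \<Longrightarrow> \<bar>f (a + h) - f a - H h h / 2\<bar> \<le> \<eta> * (norm h)\<^sup>2"
proof -
  obtain \<delta> where \<delta>: "0 < \<delta>" "ball a \<delta> \<subseteq> S"
    "\<And>k w. norm k < \<delta> \<Longrightarrow> \<bar>D (a + k) w - H k w\<bar> \<le> \<eta> * norm k * norm w"
    using gradient_estimate[OF \<eta>] by blast
  show thesis
  proof (rule that)
    show "\<delta> > 0" by (rule \<delta>)
    fix h :: 'e assume h: "norm h < \<delta>"
    \<comment> \<open>Subtracting the quadratic term first makes the mean value theorem give the constant 1/2,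
      which it would not if applied to \<open>f\<close> along the segment.\<close>
    define g where "g s = f (a + s *\<^sub>R h) - s\<^sup>2 / 2 * H h h" for s
    define g' where "g' s = D (a + s *\<^sub>R h) h - s * H h h" for s
    have small: "norm (s *\<^sub>R h) < \<delta>" if "0 \<le> s" "s \<le> 1" for s
      using that h mult_left_le_one_le[of "norm h" s] by simp
    have "(g has_real_derivative g' s) (at s)" if s: "0 \<le> s" "s \<le> 1" for s
    proof -
      have "a + s *\<^sub>R h \<in> S" using small[OF s] \<delta>(2) add_mem_ball_iff by blast
      from derivative_along_line[OF df[OF this]]
      have "((\<lambda>s. f (a + s *\<^sub>R h)) has_real_derivative D (a + s *\<^sub>R h) h) (at s)" .
      then show ?thesis unfolding g_def g'_def
        by (auto intro!: derivative_eq_intros)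
    qed
    then have "\<exists>z>0. z < 1 \<and> g 1 - g 0 = (1 - 0) * g' z"
      by (intro MVT2) auto
    then obtain z where z: "0 < z" "z < 1" "g 1 - g 0 = g' z" by auto
    have "\<bar>g' z\<bar> \<le> \<eta> * norm (z *\<^sub>R h) * norm h"
      using \<delta>(3)[OF small[of z], of h] z linear_cmul[OF hessian_bilinear(1)[of h], of z h]
      by (simp add: g'_def)
    also have "\<dots> = z * (\<eta> * (norm h)\<^sup>2)" using z by (simp add: power2_eq_square)
    also have "\<dots> \<le> \<eta> * (norm h)\<^sup>2" using z \<eta> by (intro mult_left_le_one_le) auto
    finally show "\<bar>f (a + h) - f a - H h h / 2\<bar> \<le> \<eta> * (norm h)\<^sup>2"
      using z(3) by (simp add: g_def)
  qed
qed

text \<open>The left-hand side vanishes only at 0, because a null vector of \<open>H\<close> lies in the kernel, hence in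
  the span of \<open>N\<close>, and cannot be orthogonal to all of \<open>N\<close> unless it is 0; homogeneity and compactness
  of the unit sphere do the rest.\<close>

lemma hessian_coercive_off_kernel:
  assumes psd: "\<And>v. 0 \<le> H v v"
    and ker: "\<And>v. (\<And>w. H v w = 0) \<Longrightarrow> v \<in> span N" and N: "finite N"
  obtains c where "0 < c" "\<And>h. H h h + (\<Sum>k\<in>N. (h \<bullet> k)\<^sup>2) \<ge> c * (norm h)\<^sup>2"
proof -
  obtain C :: "'e set" where C: "finite C" "\<And>b. b \<in> C \<Longrightarrow> norm b = 1"
    "\<And>x. x = (\<Sum>b\<in>C. (x \<bullet> b) *\<^sub>R b)"
    using finite_dimensional_orthonormal_basis[OF fd] by blast
  define Q where "Q h = H h h + (\<Sum>k\<in>N. (h \<bullet> k)\<^sup>2)" for h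
  have "H h h = (\<Sum>b\<in>C. (h \<bullet> b) * H h b)" for h
  proof -
    have "H h h = H h (\<Sum>b\<in>C. (h \<bullet> b) *\<^sub>R b)" by (rule arg_cong[OF C(3)])
    then show ?thesis
      by (simp add: linear_sum[OF hessian_bilinear(2)] linear_cmul[OF hessian_bilinear(2)])
  qed
  moreover have "continuous_on UNIV (\<lambda>h. H h b)" for b
    using has_derivative_bounded_linear[OF ddf] by (rule linear_continuous_on)
  ultimately have contQ: "continuous_on UNIV Q"
    unfolding Q_def by (auto intro!: continuous_intros)
  have pos: "Q h > 0" if "h \<noteq> 0" for h
  proof (rule ccontr)
    assume "\<not> Q h > 0"
    moreover have "(\<Sum>k\<in>N. (h \<bullet> k)\<^sup>2) \<ge> 0" by (intro sum_nonneg) auto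
    ultimately have z: "H h h = 0" "(\<Sum>k\<in>N. (h \<bullet> k)\<^sup>2) = 0"
      using psd[of h] by (auto simp: Q_def)
    have "H h w = 0" for w
      by (rule psd_symmetric_null[OF hessian_bilinear(1) second_derivative_symmetric[OF S df ddf] psd z(1)])
    then have "h \<in> span N" by (rule ker)
    moreover have "orthogonal h k" if "k \<in> N" for k
      using z(2) N that by (simp add: sum_nonneg_eq_0_iff orthogonal_def)
    ultimately have "orthogonal h h" using orthogonal_to_span by blast
    then show False using that by (simp add: orthogonal_def)
  qed
  have hom: "Q (r *\<^sub>R h) = r\<^sup>2 * Q h" for r h
    by (simp add: Q_def linear_cmul[OF hessian_bilinear(1)] linear_cmul[OF hessian_bilinear(2)]
        power_mult_distrib distrib_left sum_distrib_left) (simp add: power2_eq_square)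
  show thesis
  proof (cases "\<exists>h::'e. h \<noteq> 0")
    \<comment> \<open>In dimension 0 the unit sphere is empty.\<close>
    case False
    then have "h = 0" for h :: 'e by blast
    moreover have "H h h + (\<Sum>k\<in>N. (h \<bullet> k)\<^sup>2) \<ge> 0" for h
      using psd by (intro add_nonneg_nonneg sum_nonneg) auto
    ultimately show thesis
      using that[of 1] by (metis norm_zero power_zero_numeral mult_zero_right zero_less_one)
  next
    case True
    have ne: "sphere (0::'e) 1 \<noteq> {}"
    proof -
      from True obtain h :: 'e where "h \<noteq> 0" by blast
      then have "h /\<^sub>R norm h \<in> sphere 0 1" by simp
      then show ?thesis by blast
    qed
    have "compact (sphere (0::'e) 1)"
      unfolding compact_eq_bounded_closed
      by (auto simp: sphere_def bounded_iff intro!: closed_Collect_eq continuous_intros)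
    then obtain u where u: "u \<in> sphere 0 1" "\<And>h. h \<in> sphere 0 1 \<Longrightarrow> Q u \<le> Q h"
      using continuous_attains_inf[OF _ ne continuous_on_subset[OF contQ]] by blast
    show thesis
    proof (rule that)
      have "u \<noteq> 0" using u(1) by auto
      then show "Q u > 0" by (rule pos)
      fix h show "H h h + (\<Sum>k\<in>N. (h \<bullet> k)\<^sup>2) \<ge> Q u * (norm h)\<^sup>2"
      proof (cases "h = 0")
        case False
        then have "Q u \<le> Q (h /\<^sub>R norm h)" by (intro u) simp
        then have "(norm h)\<^sup>2 * Q u \<le> (norm h)\<^sup>2 * Q (h /\<^sub>R norm h)" by (intro mult_left_mono) auto
        also have "\<dots> = Q h" using False by (simp add: hom power_inverse)
        finally show ?thesis by (simp add: Q_def mult.commute)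
      qed (simp add: linear_0[OF hessian_bilinear(1)])
    qed
  qed
qed

text \<open>The growth holds not only on the orthogonal complement of the kernel but on a whole cone around
  it. This slack is needed because the orbit directions vary with the point.\<close>

lemma quadratic_growth_transverse:
  assumes psd: "\<And>v. 0 \<le> H v v"
    and ker: "\<And>v. (\<And>w. H v w = 0) \<Longrightarrow> v \<in> span N" and N: "finite N"
  obtains c \<delta> \<theta> where "0 < c" "0 < \<delta>" "0 < \<theta>"
    "\<And>h. \<lbrakk>norm h < \<delta>; \<And>k. k \<in> N \<Longrightarrow> \<bar>h \<bullet> k\<bar> \<le> \<theta> * norm h\<rbrakk> \<Longrightarrow> f (a + h) - f a \<ge> c * (norm h)\<^sup>2"
proof -
  obtain c where c: "0 < c" "\<And>h. H h h + (\<Sum>k\<in>N. (h \<bullet> k)\<^sup>2) \<ge> c * (norm h)\<^sup>2"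
    using hessian_coercive_off_kernel[OF psd ker N] by blast
  obtain \<delta> where \<delta>: "0 < \<delta>" "\<And>h. norm h < \<delta> \<Longrightarrow> \<bar>f (a + h) - f a - H h h / 2\<bar> \<le> c / 8 * (norm h)\<^sup>2"
    using second_order_taylor[of "c / 8"] c(1) by auto
  \<comment> \<open>Chosen such that \<open>|h \<bullet> k| \<le> \<theta> |h|\<close> for all \<open>k\<close> in \<open>N\<close> costs at most half of the coercivity
    constant \<open>c\<close>.\<close>
  define \<theta> where "\<theta> = sqrt (c / (2 * (card N + 1)))"
  have \<theta>: "\<theta> > 0" "card N * \<theta>\<^sup>2 \<le> c / 2"
    using c(1) by (auto simp: \<theta>_def field_simps)
  show thesis
  proof (rule that)
    show "c / 8 > 0" "\<delta> > 0" "\<theta> > 0" using c \<delta> \<theta> by auto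
    fix h assume h: "norm h < \<delta>" "\<And>k. k \<in> N \<Longrightarrow> \<bar>h \<bullet> k\<bar> \<le> \<theta> * norm h"
    have "(\<Sum>k\<in>N. (h \<bullet> k)\<^sup>2) \<le> (\<Sum>k\<in>N. \<theta>\<^sup>2 * (norm h)\<^sup>2)"
      using h(2) \<theta>(1) by (intro sum_mono) (fastforce simp: abs_mult simp flip: power_mult_distrib abs_le_square_iff)
    also have "\<dots> = (card N * \<theta>\<^sup>2) * (norm h)\<^sup>2" by simp
    also have "\<dots> \<le> c / 2 * (norm h)\<^sup>2" using \<theta>(2) by (intro mult_right_mono) auto
    finally have "H h h \<ge> c / 2 * (norm h)\<^sup>2" using c(2)[of h] by simp
    then show "f (a + h) - f a \<ge> c / 8 * (norm h)\<^sup>2" using \<delta>(2)[OF h(1)] by (simp, linarith)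
  qed
qed

end

section \<open>Charts and tangent vectors\<close>

lemma smooth_on_continuous_on: "smooth_on S h \<Longrightarrow> continuous_on S h"
  unfolding smooth_on_def by (metis k_smooth_on.simps(1))

lemma smooth_on_differentiable: "smooth_on S h \<Longrightarrow> x \<in> S \<Longrightarrow> h differentiable (at x)"
  unfolding smooth_on_def by (metis k_smooth_on.simps(2))

lemma smooth_on_has_derivative:
  "smooth_on S h \<Longrightarrow> x \<in> S \<Longrightarrow> (h has_derivative frechet_derivative h (at x)) (at x)"
  using smooth_on_differentiable frechet_derivative_works by blast

lemma smooth_on_directional_derivative:
  "smooth_on S h \<Longrightarrow> smooth_on S (\<lambda>x. frechet_derivative h (at x) v)"
  unfolding smooth_on_def by (metis k_smooth_on.simps(2))

lemma chart_cinv_cmap: "is_chart c \<Longrightarrow> p \<in> cdom c \<Longrightarrow> cinv c (cmap c p) = p"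
  unfolding is_chart_def using homeomorphism_apply1 by blast

lemma chart_open_image:
  assumes "is_chart c" "open W"
  shows "open (cmap c ` (cdom c \<inter> W))"
proof -
  have "openin (top_of_set (cmap c ` cdom c)) (cmap c ` (cdom c \<inter> W))"
    using assms homeomorphism_imp_open_map unfolding is_chart_def
    by (metis openin_open_Int)
  then show ?thesis
    using assms(1) openin_open_trans unfolding is_chart_def by blast
qed

lemma chart_open_preimage:
  assumes "is_chart c" "open Y"
  shows "open (cdom c \<inter> cmap c -` Y)"
  using assms unfolding is_chart_def homeomorphism_def
  by (meson continuous_open_preimage)

lemma chart_around: "smooth_manifold A \<Longrightarrow> \<exists>c\<in>A. p \<in> cdom c"
  unfolding smooth_manifold_def by (metis UN_iff UNIV_I)

text \<open>A tangent vector may be prescribed by its coordinates in one chart, so that statements about all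
  tangent vectors at \<open>p\<close> become statements about all vectors of the model space.\<close>

lemma tangent_vector_with_coordinate:
  assumes A: "smooth_manifold A" and c: "c \<in> A" "p \<in> cdom c"
  obtains v where "v \<in> tangent_space A p" "v c = x"
proof -
  have charts: "is_chart d" if "d \<in> A" for d using A that by (simp add: smooth_manifold_def)
  define v where "v d = (if d \<in> A \<and> p \<in> cdom d
    then frechet_derivative (cmap d \<circ> cinv c) (at (cmap c p)) x else 0)" for d
  have trans: "(cmap d' \<circ> cinv d) differentiable (at (cmap d p))"
    if "d \<in> A" "d' \<in> A" "p \<in> cdom d" "p \<in> cdom d'" for d d'
  proof (rule smooth_on_differentiable)
    show "smooth_on (cmap d ` (cdom d \<inter> cdom d')) (cmap d' \<circ> cinv d)"
      using A that(1,2) by (simp add: smooth_manifold_def)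
  qed (use that in blast)
  have "v d' = frechet_derivative (cmap d' \<circ> cinv d) (at (cmap d p)) (v d)"
    if d: "d \<in> A" "p \<in> cdom d" and d': "d' \<in> A" "p \<in> cdom d'" for d d'
  proof -
    have at: "(cmap d \<circ> cinv c) (cmap c p) = cmap d p"
      using chart_cinv_cmap[OF charts[OF c(1)] c(2)] by simp
    have "frechet_derivative (cmap d' \<circ> cinv c) (at (cmap c p))
        = frechet_derivative ((cmap d' \<circ> cinv d) \<circ> (cmap d \<circ> cinv c)) (at (cmap c p))"
    proof (rule frechet_derivative_transform_within_open)
      show "(cmap d' \<circ> cinv c) differentiable at (cmap c p)" using trans c d' by blast
      show "open (cmap c ` (cdom c \<inter> cdom d))"
        using chart_open_image charts c(1) d(1) by (meson is_chart_def)
      show "cmap c p \<in> cmap c ` (cdom c \<inter> cdom d)" using c d by blast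
      show "(cmap d' \<circ> cinv c) y = ((cmap d' \<circ> cinv d) \<circ> (cmap d \<circ> cinv c)) y"
        if "y \<in> cmap c ` (cdom c \<inter> cdom d)" for y
        using that chart_cinv_cmap[OF charts[OF c(1)]] chart_cinv_cmap[OF charts[OF d(1)]] by auto
    qed
    also have "\<dots> = frechet_derivative (cmap d' \<circ> cinv d) (at (cmap d p))
        \<circ> frechet_derivative (cmap d \<circ> cinv c) (at (cmap c p))"
      using frechet_derivative_compose[of "cmap d \<circ> cinv c" "cmap c p" "cmap d' \<circ> cinv d"]
        trans c d d' unfolding at by blast
    finally show ?thesis using d d' by (simp add: v_def)
  qed
  moreover have "v d = 0" if "\<not> (d \<in> A \<and> p \<in> cdom d)" for d
    using that by (auto simp: v_def)
  ultimately have v: "v \<in> tangent_space A p"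
    unfolding tangent_space_def by blast
  have "frechet_derivative (cmap c \<circ> cinv c) (at (cmap c p)) = frechet_derivative (\<lambda>y. y) (at (cmap c p))"
  proof (rule frechet_derivative_transform_within_open)
    show "(cmap c \<circ> cinv c) differentiable at (cmap c p)" using trans c by blast
    show "open (cmap c ` cdom c)" using charts c(1) by (simp add: is_chart_def)
    show "cmap c p \<in> cmap c ` cdom c" using c(2) by blast
    show "(cmap c \<circ> cinv c) y = y" if "y \<in> cmap c ` cdom c" for y
      using that by (simp add: f_inv_into_f)
  qed
  also have "\<dots> = (\<lambda>y. y)" by (rule frechet_derivative_at[OF has_derivative_ident, symmetric])
  finally have "v c = x" using c by (simp add: v_def)
  with v show thesis by (rule that)
qed

section \<open>The action and its infinitesimal generators in a chart\<close>

text \<open>The image of \<open>UNIV \<times> K\<close> under the proper map \<open>(g, x) \<mapsto> (g \<cdot> x, x)\<close> is closed, and projecting it along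
  the compact factor \<open>K\<close> keeps it closed.\<close>

lemma proper_action_closed_saturation:
  fixes \<Phi> :: "'g::t2_space \<Rightarrow> 'm::t2_space \<Rightarrow> 'm"
  assumes "proper_action \<Phi>" "compact K"
  shows "closed (\<Union>g. \<Phi> g ` K)"
proof -
  define Z where "Z = (\<lambda>(g, x). (\<Phi> g x, x)) ` (UNIV \<times> K)"
  have "closed (UNIV \<times> K :: ('g \<times> 'm) set)"
    by (rule closed_Times[OF closed_UNIV compact_imp_closed[OF assms(2)]])
  then have "closed Z"
    using proper_imp_closed_map[OF assms(1)[unfolded proper_action_def]]
    unfolding Z_def closed_map_def by auto
  then have "closedin (top_of_set (UNIV \<times> K)) Z"
    by (rule closed_subset[rotated]) (auto simp: Z_def)
  moreover have "closed_map (prod_topology (top_of_set UNIV) (top_of_set K)) (top_of_set (UNIV :: 'm set)) fst"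
    using assms(2) by (intro Abstract_Topological_Spaces.closed_map_fst compact_space_subtopology) simp
  ultimately have "closed (fst ` Z)"
    unfolding closed_map_def prod_topology_subtopology_eu by auto
  moreover have "fst ` Z = (\<Union>g. \<Phi> g ` K)" by (force simp: Z_def)
  ultimately show ?thesis by simp
qed

text \<open>The coordinate expression of the action in a chart \<open>d\<close> of the group and a chart \<open>c\<close> of the
  manifold, used for source and target alike. It is written with the inverse of the product chart,
  so that smoothness of the action applies to it literally; its values are given by
  \<open>chart_action_apply\<close> below.\<close>

definition chart_action ::
    "('g, 'h) chart \<Rightarrow> ('m, 'e) chart \<Rightarrow> ('g \<Rightarrow> 'm \<Rightarrow> 'm) \<Rightarrow> 'h \<times> 'e \<Rightarrow> 'e" where
  "chart_action d c \<Phi> =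
     cmap c \<circ> (\<lambda>(g, x). \<Phi> g x) \<circ> cinv (cdom d \<times> cdom c, map_prod (cmap d) (cmap c))"

lemma chart_action_apply:
  assumes "is_chart d" "is_chart c" "g \<in> cdom d" "x \<in> cdom c"
  shows "chart_action d c \<Phi> (cmap d g, cmap c x) = cmap c (\<Phi> g x)"
proof -
  have "inj_on (cmap d) (cdom d)" "inj_on (cmap c) (cdom c)"
    using chart_cinv_cmap assms(1,2) by (metis inj_onI)+
  then have "inj_on (map_prod (cmap d) (cmap c)) (cdom d \<times> cdom c)"
    by (rule map_prod_inj_on)
  then have "inv_into (cdom d \<times> cdom c) (map_prod (cmap d) (cmap c)) (map_prod (cmap d) (cmap c) (g, x)) = (g, x)"
    using assms by (intro inv_into_f_f) auto
  then show ?thesis by (simp add: chart_action_def)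
qed

lemma chart_action_smooth:
  assumes "smooth_map (prod_atlas B A) A (\<lambda>(g, x). \<Phi> g x)" "d \<in> B" "c \<in> A"
  shows "smooth_on {(cmap d g, cmap c x) | g x. g \<in> cdom d \<and> x \<in> cdom c \<and> \<Phi> g x \<in> cdom c} (chart_action d c \<Phi>)"
proof -
  define C where "C = (cdom d \<times> cdom c, map_prod (cmap d) (cmap c))"
  have "C \<in> prod_atlas B A" using assms(2,3) unfolding prod_atlas_def C_def by blast
  then have "smooth_on (cmap C ` (cdom C \<inter> (\<lambda>(g, x). \<Phi> g x) -` cdom c)) (cmap c \<circ> (\<lambda>(g, x). \<Phi> g x) \<circ> cinv C)"
    using assms by (simp add: smooth_map_def)
  moreover have "cmap C ` (cdom C \<inter> (\<lambda>(g, x). \<Phi> g x) -` cdom c)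
      = {(cmap d g, cmap c x) | g x. g \<in> cdom d \<and> x \<in> cdom c \<and> \<Phi> g x \<in> cdom c}"
    by (force simp: C_def)
  ultimately show ?thesis by (simp add: chart_action_def C_def)
qed

text \<open>In this context \<open>c\<close> is any chart of the manifold and \<open>d\<close> is a chart of the group around the
  identity.\<close>

context
  fixes A :: "('m::{t2_space,second_countable_topology}, 'e::{real_inner,heine_borel}) chart set"
    and B :: "('g::{t2_space,second_countable_topology}, 'h::{real_inner,heine_borel}) chart set"
    and G :: "('g, 'r) monoid_scheme"
    and \<Phi> :: "'g \<Rightarrow> 'm \<Rightarrow> 'm" and c d
  assumes A: "smooth_manifold A" and B: "lie_group B G" and act: "smooth_action B G A \<Phi>"
    and c: "c \<in> A" and d: "d \<in> B" "\<one>\<^bsub>G\<^esub> \<in> cdom d"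
begin

lemma chart_c: "is_chart c" using A c by (simp add: smooth_manifold_def)
lemma chart_d: "is_chart d" using B d by (simp add: lie_group_def smooth_manifold_def)

lemma action_one: "\<Phi> \<one>\<^bsub>G\<^esub> x = x"
proof -
  interpret group_action G UNIV \<Phi> using act by (simp add: smooth_action_def)
  show ?thesis using id_eq_one by (metis UNIV_I restrict_apply')
qed

lemma action_mult: "\<Phi> (g \<otimes>\<^bsub>G\<^esub> h) x = \<Phi> g (\<Phi> h x)"
proof -
  interpret group_action G UNIV \<Phi> using act by (simp add: smooth_action_def)
  show ?thesis using composition_rule B by (simp add: lie_group_def)
qed

lemma action_inverse: "\<Phi> (inv\<^bsub>G\<^esub> g) (\<Phi> g x) = x" "\<Phi> g (\<Phi> (inv\<^bsub>G\<^esub> g) x) = x"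
proof -
  interpret group G using B by (simp add: lie_group_def)
  have "g \<in> carrier G" using B by (simp add: lie_group_def)
  then show "\<Phi> (inv\<^bsub>G\<^esub> g) (\<Phi> g x) = x" "\<Phi> g (\<Phi> (inv\<^bsub>G\<^esub> g) x) = x"
    by (simp_all add: action_one flip: action_mult)
qed

lemma action_continuous: "continuous_on UNIV (\<lambda>g. \<Phi> g x)" "continuous_on UNIV (\<lambda>x. \<Phi> g x)"
proof -
  have *: "continuous_on UNIV (\<lambda>(g, x). \<Phi> g x)"
    using act by (simp add: smooth_action_def smooth_map_def)
  have "continuous_on UNIV (\<lambda>g. (g, x))" "continuous_on UNIV (\<lambda>x. (g, x))"
    by (intro continuous_intros)+
  from this[THEN continuous_on_compose2[OF * _ subset_UNIV]]
  show "continuous_on UNIV (\<lambda>g. \<Phi> g x)" "continuous_on UNIV (\<lambda>x. \<Phi> g x)"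
    by simp_all
qed

lemma saturation_open:
  assumes "open N" shows "open (\<Union>g. \<Phi> g ` N)"
proof -
  have "\<Phi> g ` N = \<Phi> (inv\<^bsub>G\<^esub> g) -` N" for g
    using action_inverse[of g] by (auto intro: image_eqI[where x = "\<Phi> (inv\<^bsub>G\<^esub> g) _"])
  then show ?thesis using assms action_continuous(2) by (auto intro!: open_vimage)
qed

text \<open>The derivative of the coordinate expression of the action at the identity of the group, in the
  group direction \<open>\<eta>\<close> (a coordinate vector of the Lie algebra in the chart \<open>d\<close>) and at the point with
  coordinates \<open>y\<close>. It needs no one-parameter subgroup with velocity \<open>\<eta>\<close>.\<close>

definition chart_generator :: "'h \<Rightarrow> 'e \<Rightarrow> 'e" where
  "chart_generator \<eta> y = frechet_derivative (chart_action d c \<Phi>) (at (cmap d \<one>\<^bsub>G\<^esub>, y)) (\<eta>, 0)"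

lemma chart_action_has_derivative:
  assumes "x \<in> cdom c"
  shows "(chart_action d c \<Phi> has_derivative frechet_derivative (chart_action d c \<Phi>) (at (cmap d \<one>\<^bsub>G\<^esub>, cmap c x)))
    (at (cmap d \<one>\<^bsub>G\<^esub>, cmap c x))"
proof (rule smooth_on_has_derivative[OF chart_action_smooth])
  show "smooth_map (prod_atlas B A) A (\<lambda>(g, x). \<Phi> g x)" using act by (simp add: smooth_action_def)
  show "(cmap d \<one>\<^bsub>G\<^esub>, cmap c x) \<in> {(cmap d g, cmap c x) | g x. g \<in> cdom d \<and> x \<in> cdom c \<and> \<Phi> g x \<in> cdom c}"
    unfolding mem_Collect_eq
    by (intro exI[of _ "\<one>\<^bsub>G\<^esub>"] exI[of _ x]) (simp add: d assms action_one)
qed (use c d in auto)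

lemma chart_generator_continuous: "continuous_on (cmap c ` cdom c) (chart_generator \<eta>)"
proof -
  define T where "T = {(cmap d g, cmap c x) | g x. g \<in> cdom d \<and> x \<in> cdom c \<and> \<Phi> g x \<in> cdom c}"
  have "smooth_on T (chart_action d c \<Phi>)"
    unfolding T_def using act c d by (intro chart_action_smooth) (auto simp: smooth_action_def)
  then have *: "continuous_on T (\<lambda>z. frechet_derivative (chart_action d c \<Phi>) (at z) (\<eta>, 0))"
    by (intro smooth_on_continuous_on smooth_on_directional_derivative)
  have "(\<lambda>y. (cmap d \<one>\<^bsub>G\<^esub>, y)) ` (cmap c ` cdom c) \<subseteq> T"
    using d action_one by (fastforce simp: T_def)
  moreover have "continuous_on (cmap c ` cdom c) (\<lambda>y. (cmap d \<one>\<^bsub>G\<^esub>, y))"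
    by (intro continuous_intros)
  ultimately show ?thesis
    unfolding chart_generator_def by (intro continuous_on_compose2[OF *])
qed

lemma inf_generator_chart:
  assumes m: "m \<in> cdom c" and gen: "inf_generator_at B G A \<Phi> \<xi> m v"
  shows "v c = chart_generator (\<xi> d) (cmap c m)"
proof -
  obtain \<gamma> where \<gamma>: "exp_curve B G \<xi> \<gamma>" "has_velocity A (\<lambda>t. \<Phi> (\<gamma> t) m) v 0"
    using gen by (auto simp: inf_generator_at_def)
  interpret group G using B by (simp add: lie_group_def)
  have "\<gamma> 0 = \<gamma> 0 \<otimes>\<^bsub>G\<^esub> \<gamma> 0"
    using \<gamma>(1) unfolding exp_curve_def one_parameter_subgroup_def by (metis add_0)
  then have \<gamma>0: "\<gamma> 0 = \<one>\<^bsub>G\<^esub>"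
    using B by (metis UNIV_I l_cancel_one lie_group_def)
  have vel: "isCont \<gamma> 0" "((cmap d \<circ> \<gamma>) has_vector_derivative \<xi> d) (at 0)"
    using \<gamma>(1) d \<gamma>0 by (auto simp: exp_curve_def has_velocity_def)
  have "((\<lambda>t. (cmap d (\<gamma> t), cmap c m)) has_derivative (\<lambda>t. (t *\<^sub>R \<xi> d, 0))) (at 0)"
    using vel(2) by (auto intro!: has_derivative_Pair simp: has_vector_derivative_def o_def)
  from has_derivative_compose[OF this, of "chart_action d c \<Phi>"] chart_action_has_derivative[OF m]
  have "((\<lambda>t. chart_action d c \<Phi> (cmap d (\<gamma> t), cmap c m)) has_derivative
      (\<lambda>t. frechet_derivative (chart_action d c \<Phi>) (at (cmap d \<one>\<^bsub>G\<^esub>, cmap c m)) (t *\<^sub>R \<xi> d, 0))) (at 0)"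
    by (simp add: \<gamma>0)
  moreover have "frechet_derivative (chart_action d c \<Phi>) (at (cmap d \<one>\<^bsub>G\<^esub>, cmap c m)) (t *\<^sub>R \<xi> d, 0)
      = t *\<^sub>R chart_generator (\<xi> d) (cmap c m)" for t
    unfolding chart_generator_def
    using linear_cmul[OF has_derivative_linear[OF chart_action_has_derivative[OF m]], of t "(\<xi> d, 0)"] by simp
  ultimately have der: "((\<lambda>t. chart_action d c \<Phi> (cmap d (\<gamma> t), cmap c m)) has_derivative
      (\<lambda>t. t *\<^sub>R chart_generator (\<xi> d) (cmap c m))) (at 0)"
    by simp
  have "\<forall>\<^sub>F t in at 0. \<gamma> t \<in> cdom d"
    using vel(1) chart_d d(2) \<gamma>0 unfolding isCont_def is_chart_def by (metis topological_tendstoD)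
  then have "\<forall>\<^sub>F t in at 0. chart_action d c \<Phi> (cmap d (\<gamma> t), cmap c m) = (cmap c \<circ> (\<lambda>t. \<Phi> (\<gamma> t) m)) t"
    by eventually_elim (simp add: chart_action_apply chart_c chart_d m)
  then have "((cmap c \<circ> (\<lambda>t. \<Phi> (\<gamma> t) m)) has_derivative (\<lambda>t. t *\<^sub>R chart_generator (\<xi> d) (cmap c m))) (at 0)"
    by (rule has_derivative_transform_eventually[OF der])
      (simp_all add: chart_action_apply chart_c chart_d m d \<gamma>0)
  moreover have "((cmap c \<circ> (\<lambda>t. \<Phi> (\<gamma> t) m)) has_vector_derivative v c) (at 0)"
    using \<gamma>(2) c m by (auto simp: has_velocity_def \<gamma>0 action_one)
  ultimately show ?thesis
    by (metis has_vector_derivative_def vector_derivative_unique_at)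
qed

text \<open>If no point of the orbit of \<open>x\<close> within the chart is closer to \<open>y0\<close> than \<open>x\<close> itself, then the segment
  from \<open>y0\<close> to \<open>x\<close> is orthogonal to the orbit directions at \<open>x\<close>. This takes the place of a slice at
  \<open>m\<close>.\<close>

lemma orbit_minimizer_orthogonal:
  assumes x: "x \<in> cdom c"
    and min: "\<And>g. \<Phi> g x \<in> cdom c \<Longrightarrow> norm (cmap c x - y0) \<le> norm (cmap c (\<Phi> g x) - y0)"
  shows "(cmap c x - y0) \<bullet> chart_generator \<eta> (cmap c x) = 0"
proof -
  define u where "u = cmap d \<one>\<^bsub>G\<^esub>"
  define p where "p s = chart_action d c \<Phi> (u + s *\<^sub>R \<eta>, cmap c x) - y0" for s
  define E' where "E' = frechet_derivative (chart_action d c \<Phi>) (at (u, cmap c x))"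
  have E': "(chart_action d c \<Phi> has_derivative E') (at (u + 0 *\<^sub>R \<eta>, cmap c x))"
    using chart_action_has_derivative[OF x] by (simp add: E'_def u_def)
  have p0: "p 0 = cmap c x - y0"
    using d x by (simp add: p_def u_def chart_action_apply chart_c chart_d action_one)
  have "((\<lambda>s. (u + s *\<^sub>R \<eta>, cmap c x)) has_derivative (\<lambda>s. (s *\<^sub>R \<eta>, 0))) (at 0)"
    by (auto intro!: derivative_eq_intros)
  then have "((\<lambda>s. chart_action d c \<Phi> (u + s *\<^sub>R \<eta>, cmap c x)) has_derivative (\<lambda>s. E' (s *\<^sub>R \<eta>, 0))) (at 0)"
    using E' by (rule has_derivative_compose)
  moreover have "E' (s *\<^sub>R \<eta>, 0) = s *\<^sub>R chart_generator \<eta> (cmap c x)" for s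
    using linear_cmul[OF has_derivative_linear[OF E'], of s "(\<eta>, 0)"]
    by (simp add: chart_generator_def E'_def u_def)
  ultimately have dp: "(p has_derivative (\<lambda>s. s *\<^sub>R chart_generator \<eta> (cmap c x))) (at 0)"
    unfolding p_def by (auto intro!: derivative_eq_intros)
  have "((\<lambda>s. p s \<bullet> p s) has_derivative (\<lambda>s. p 0 \<bullet> (s *\<^sub>R chart_generator \<eta> (cmap c x))
      + (s *\<^sub>R chart_generator \<eta> (cmap c x)) \<bullet> p 0)) (at 0)"
    by (rule has_derivative_inner[OF dp dp])
  then have dq: "((\<lambda>s. p s \<bullet> p s) has_real_derivative 2 * (p 0 \<bullet> chart_generator \<eta> (cmap c x))) (at 0)"
    by (simp add: has_field_derivative_def inner_commute algebra_simps mult_commute_abs)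
  have "\<forall>\<^sub>F s in nhds 0. u + s *\<^sub>R \<eta> \<in> cmap d ` cdom d \<and> \<Phi> (cinv d (u + s *\<^sub>R \<eta>)) x \<in> cdom c"
  proof -
    have op: "open (cmap d ` cdom d)" "open (cdom c)"
      using chart_c chart_d by (auto simp: is_chart_def)
    have "continuous_on (cmap d ` cdom d) (cinv d)"
      using chart_d by (simp add: is_chart_def homeomorphism_def)
    then have cont: "continuous_on (cmap d ` cdom d) (\<lambda>z. \<Phi> (cinv d z) x)"
      by (rule continuous_on_compose2[OF action_continuous(1)]) auto
    have op2: "open (cmap d ` cdom d \<inter> (\<lambda>z. \<Phi> (cinv d z) x) -` cdom c)"
      by (rule continuous_open_preimage[OF cont op])
    have "isCont (\<lambda>s. u + s *\<^sub>R \<eta>) 0" by (intro continuous_intros)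
    then have "((\<lambda>s. u + s *\<^sub>R \<eta>) \<longlongrightarrow> u + 0 *\<^sub>R \<eta>) (nhds 0)"
      using tendsto_at_iff_tendsto_nhds[of "\<lambda>s. u + s *\<^sub>R \<eta>" 0] by (simp add: isCont_def)
    moreover have "u + 0 *\<^sub>R \<eta> \<in> cmap d ` cdom d \<inter> (\<lambda>z. \<Phi> (cinv d z) x) -` cdom c"
      using d x by (simp add: u_def chart_cinv_cmap chart_d action_one)
    ultimately have "\<forall>\<^sub>F s in nhds 0. u + s *\<^sub>R \<eta> \<in> cmap d ` cdom d \<inter> (\<lambda>z. \<Phi> (cinv d z) x) -` cdom c"
      using op2 by (metis topological_tendstoD)
    then show ?thesis by simp
  qed
  then obtain e where e: "e > 0"
    "\<And>s. dist s 0 < e \<Longrightarrow> u + s *\<^sub>R \<eta> \<in> cmap d ` cdom d \<and> \<Phi> (cinv d (u + s *\<^sub>R \<eta>)) x \<in> cdom c"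
    unfolding eventually_nhds_metric by blast
  have "p 0 \<bullet> p 0 \<le> p s \<bullet> p s" if "\<bar>0 - s\<bar> < e" for s
  proof -
    have s: "u + s *\<^sub>R \<eta> \<in> cmap d ` cdom d" "\<Phi> (cinv d (u + s *\<^sub>R \<eta>)) x \<in> cdom c"
      using e(2)[of s] that by (auto simp: dist_norm)
    obtain g where g: "g \<in> cdom d" "u + s *\<^sub>R \<eta> = cmap d g" using s(1) by blast
    then have "p s = cmap c (\<Phi> g x) - y0"
      using x by (simp add: p_def chart_action_apply chart_c chart_d)
    moreover have "\<Phi> g x \<in> cdom c" using s(2) g by (simp add: chart_cinv_cmap chart_d)
    ultimately have "norm (p 0) \<le> norm (p s)" using min p0 by simp
    then show ?thesis by (simp add: norm_le)
  qed
  with DERIV_local_min[OF dq e(1)] show ?thesis by (simp add: p0)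
qed

end

section \<open>Stability from invariant barriers\<close>

lemma path_stays_inside:
  fixes p :: "real \<Rightarrow> 'a::topological_space"
  assumes "open W" "p 0 \<in> W" "continuous_on {0..t} p"
    and "\<And>s. 0 < s \<Longrightarrow> s \<le> t \<Longrightarrow> p s \<notin> frontier W" and "0 \<le> t"
  shows "p t \<in> W"
proof (rule ccontr)
  assume "p t \<notin> W"
  have "connected (p ` {0..t})"
    by (rule connected_continuous_image[OF assms(3)]) simp
  then have "p ` {0..t} \<inter> frontier W \<noteq> {}"
    using assms(2,5) \<open>p t \<notin> W\<close> by (intro connected_Int_frontier) force+
  then obtain s where s: "0 \<le> s" "s \<le> t" "p s \<in> frontier W" by auto
  have "p 0 \<notin> frontier W" using assms(1,2) by (simp add: frontier_def interior_open)
  then have "s \<noteq> 0" using s(3) by blast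
  with s assms(4)[of s] show False by simp
qed

lemma stable_modulo_if_barriers:
  fixes F :: "real \<Rightarrow> 'm::topological_space \<Rightarrow> 'm" and f :: "'m \<Rightarrow> real"
  assumes F0: "\<And>x. F 0 x = x" and cont: "\<And>x. continuous_on UNIV (\<lambda>t. F t x)"
    and small: "\<And>\<epsilon>::real. \<epsilon> > 0 \<Longrightarrow> \<exists>V. open V \<and> m \<in> V \<and> (\<forall>t>0. f ` (F t ` V) \<subseteq> {0..<\<epsilon>})"
    and barrier: "\<And>U. \<lbrakk>open U; \<And>g. g \<in> H \<Longrightarrow> \<Phi> g ` U \<subseteq> U; (\<lambda>g. \<Phi> g m) ` H \<subseteq> U\<rbrakk> \<Longrightarrow>
      \<exists>W \<epsilon>. open W \<and> m \<in> W \<and> W \<subseteq> U \<and> \<epsilon> > 0 \<and> (\<forall>z\<in>frontier W. \<epsilon> \<le> f z)"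
  shows "stable_modulo H \<Phi> F m"
  unfolding stable_modulo_def
proof (intro allI impI)
  fix U assume "open U \<and> (\<forall>g\<in>H. \<Phi> g ` U \<subseteq> U) \<and> (\<lambda>g. \<Phi> g m) ` H \<subseteq> U"
  then obtain W \<epsilon> where W: "open W" "m \<in> W" "W \<subseteq> U" "\<epsilon> > 0" "\<And>z. z \<in> frontier W \<Longrightarrow> \<epsilon> \<le> f z"
    using barrier[of U] by blast
  obtain V where V: "open V" "m \<in> V" "\<And>t. t > 0 \<Longrightarrow> f ` (F t ` V) \<subseteq> {0..<\<epsilon>}"
    using small[OF W(4)] by blast
  have "F t x \<in> W" if "0 \<le> t" "x \<in> V \<inter> W" for t x
  proof (rule path_stays_inside[OF W(1)])
    show "F 0 x \<in> W" using that F0 by simp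
    show "continuous_on {0..t} (\<lambda>t. F t x)" using cont continuous_on_subset by blast
    fix s :: real assume "0 < s" "s \<le> t"
    then have "f (F s x) < \<epsilon>" using V(3)[of s] that(2) by (auto simp: image_subset_iff)
    then show "F s x \<notin> frontier W" using W(5) by fastforce
  qed (rule that)
  then show "\<exists>V. open V \<and> m \<in> V \<and> V \<subseteq> U \<and> (\<forall>t\<ge>0. F t ` V \<subseteq> U)"
    using V W by (intro exI[of _ "V \<inter> W"]) auto
qed

lemma flow_continuous: "flow_of A X F \<Longrightarrow> continuous_on UNIV (\<lambda>t. F t x)"
  unfolding flow_of_def trajectory_def has_velocity_def
  by (simp add: continuous_at_imp_continuous_on)

text \<open>The barrier is the saturation of a small chart ball of radius \<open>r\<close> around \<open>m\<close>. A point of its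
  frontier is in the orbit of a point \<open>x\<close> of the sphere of radius \<open>r\<close> whose orbit misses the open
  ball; so \<open>x\<close> is closest to \<open>m\<close> in its orbit, is displaced from \<open>m\<close> transversally to the kernel of
  the Hessian, and has \<open>f x \<ge> C r\<^sup>2\<close>.\<close>

lemma invariant_barrier:
  fixes A :: "('m::{t2_space,second_countable_topology}, 'e::{real_inner,heine_borel}) chart set"
    and B :: "('g::{t2_space,second_countable_topology}, 'h::{real_inner,heine_borel}) chart set"
    and G :: "('g, 'r) monoid_scheme"
    and \<Phi> :: "'g \<Rightarrow> 'm \<Rightarrow> 'm"
  assumes A: "smooth_manifold A" and B: "lie_group B G"
    and act: "smooth_action B G A \<Phi>" and proper: "proper_action \<Phi>"
    and smooth: "smooth_map A vec_atlas f" and inv: "invariant_function G \<Phi> f"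
    and crit: "critical_point A f m" and fm: "f m = 0"
    and psd: "pos_semidefinite_on (tangent_space A m) (hessian A f m)"
    and ker: "form_kernel (tangent_space A m) (hessian A f m) = orbit_tangent_space B G A \<Phi> m"
    and U: "open U" "\<And>g. \<Phi> g ` U \<subseteq> U" "m \<in> U"
  shows "\<exists>W \<epsilon>. open W \<and> m \<in> W \<and> W \<subseteq> U \<and> \<epsilon> > 0 \<and> (\<forall>z\<in>frontier W. \<epsilon> \<le> f z)"
proof -
  define c where "c = chart_at A m"
  have "\<exists>c. c \<in> A \<and> m \<in> cdom c" using chart_around[OF A] by blast
  then have c: "c \<in> A" "m \<in> cdom c"
    unfolding c_def chart_at_def by (metis (mono_tags, lifting) someI_ex)+
  obtain d where d: "d \<in> B" "\<one>\<^bsub>G\<^esub> \<in> cdom d"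
    using chart_around B unfolding lie_group_def by blast
  note ctx = A B act c(1) d
  have chart: "is_chart c" using A c by (simp add: smooth_manifold_def)
  have cont_c: "continuous_on (cdom c) (cmap c)" and cont_ci: "continuous_on (cmap c ` cdom c) (cinv c)"
    using chart by (simp_all add: is_chart_def homeomorphism_def)
  have fd: "finite_dimensional TYPE('e)" using A by (simp add: smooth_manifold_def)

  define y0 where "y0 = cmap c m"
  define S where "S = cmap c ` cdom c"
  have S: "open S" "y0 \<in> S" using chart c(2) by (auto simp: S_def y0_def is_chart_def)
  define \<phi> where "\<phi> = f \<circ> cinv c"
  have \<phi>: "smooth_on S \<phi>"
    using smooth c(1) unfolding smooth_map_def by (auto simp: vec_atlas_def S_def \<phi>_def)
  define D where "D x = frechet_derivative \<phi> (at x)" for x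
  define H where "H v w = frechet_derivative (\<lambda>x. D x w) (at y0) v" for v w
  have D: "(\<phi> has_derivative D x) (at x)" if "x \<in> S" for x
    unfolding D_def by (rule smooth_on_has_derivative[OF \<phi> that])
  have H: "((\<lambda>x. D x w) has_derivative (\<lambda>v. H v w)) (at y0)" for w
    using smooth_on_has_derivative[OF smooth_on_directional_derivative[OF \<phi>] S(2)]
    by (simp add: H_def D_def)
  have lift: "\<exists>v\<in>tangent_space A m. v c = x" for x
    using tangent_vector_with_coordinate[OF A c] by metis
  have diff: "differential A f m v = D y0 (v c)" for v
    by (simp add: differential_def Let_def D_def \<phi>_def y0_def flip: c_def)
  have D0: "D y0 w = 0" for w
    using crit lift[of w] by (auto simp: critical_point_def diff)
  have hess: "hessian A f m v w = H (v c) (w c)" for v w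
    by (simp add: hessian_def Let_def H_def D_def \<phi>_def y0_def flip: c_def)
  have Hpsd: "0 \<le> H v v" for v
    using psd lift[of v] by (auto simp: pos_semidefinite_on_def hess)

  define K where "K = {v. \<forall>w. H v w = 0}"
  obtain N where N: "N \<subseteq> K" "independent N" "K \<subseteq> span N"
    using maximal_independent_subset by blast
  have finN: "finite N"
    using fd independent_span_bound[OF _ N(2)] unfolding finite_dimensional_def by (metis UNIV_I subsetI)
  \<comment> \<open>Each vector of the kernel is the coordinate vector of a generator at \<open>m\<close>.\<close>
  have "\<exists>\<eta>. chart_generator G \<Phi> c d \<eta> y0 = k" if "k \<in> N" for k
  proof -
    obtain v where v: "v \<in> tangent_space A m" "v c = k" using lift by blast
    have "v \<in> form_kernel (tangent_space A m) (hessian A f m)"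
      using v N(1) that by (auto simp: form_kernel_def hess K_def)
    then obtain \<xi> where "inf_generator_at B G A \<Phi> \<xi> m v"
      using ker by (auto simp: orbit_tangent_space_def)
    then show ?thesis
      using inf_generator_chart[OF ctx c(2)] v(2) y0_def by metis
  qed
  then obtain \<eta> where \<eta>: "\<And>k. k \<in> N \<Longrightarrow> chart_generator G \<Phi> c d (\<eta> k) y0 = k" by metis

  obtain C \<delta> \<theta> where grow: "0 < C" "0 < \<delta>" "0 < \<theta>"
    "\<And>h. \<lbrakk>norm h < \<delta>; \<And>k. k \<in> N \<Longrightarrow> \<bar>h \<bullet> k\<bar> \<le> \<theta> * norm h\<rbrakk> \<Longrightarrow> \<phi> (y0 + h) - \<phi> y0 \<ge> C * (norm h)\<^sup>2"
    using quadratic_growth_transverse[OF fd S D H D0 Hpsd _ finN] N(3) unfolding K_def by blast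

  have "\<forall>k\<in>N. \<forall>\<^sub>F y in nhds y0. dist (chart_generator G \<Phi> c d (\<eta> k) y) k < \<theta>"
  proof
    fix k assume k: "k \<in> N"
    have "isCont (chart_generator G \<Phi> c d (\<eta> k)) y0"
      using chart_generator_continuous[OF ctx] S continuous_on_eq_continuous_at unfolding S_def by blast
    then have "(chart_generator G \<Phi> c d (\<eta> k) \<longlongrightarrow> k) (nhds y0)"
      using tendsto_at_iff_tendsto_nhds[of "chart_generator G \<Phi> c d (\<eta> k)" y0] \<eta>[OF k]
      by (simp add: isCont_def)
    then show "\<forall>\<^sub>F y in nhds y0. dist (chart_generator G \<Phi> c d (\<eta> k) y) k < \<theta>"
      using grow(3) by (rule tendstoD)
  qed
  then have "\<forall>\<^sub>F y in nhds y0. \<forall>k\<in>N. dist (chart_generator G \<Phi> c d (\<eta> k) y) k < \<theta>"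
    by (rule eventually_ball_finite[OF finN])
  then obtain \<rho> where \<rho>: "\<rho> > 0"
    "\<And>y k. \<lbrakk>dist y y0 < \<rho>; k \<in> N\<rbrakk> \<Longrightarrow> dist (chart_generator G \<Phi> c d (\<eta> k) y) k < \<theta>"
    unfolding eventually_nhds_metric by blast

  have "open (cmap c ` (cdom c \<inter> U))" "y0 \<in> cmap c ` (cdom c \<inter> U)"
    using chart_open_image[OF chart U(1)] c(2) U(3) by (auto simp: y0_def)
  then obtain e where e: "e > 0" "cball y0 e \<subseteq> cmap c ` (cdom c \<inter> U)"
    using open_contains_cball by blast
  define r where "r = min e (min \<delta> \<rho> / 2)"
  have r: "0 < r" "r < \<delta>" "r < \<rho>" "cball y0 r \<subseteq> cmap c ` (cdom c \<inter> U)"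
    using e \<rho>(1) grow(2) by (auto simp: r_def)
  define N0 where "N0 = cdom c \<inter> cmap c -` ball y0 r"
  define K0 where "K0 = cinv c ` cball y0 r"
  have ci: "cinv c y \<in> cdom c \<inter> U" "cmap c (cinv c y) = y" if "y \<in> cball y0 r" for y
    using that r(4) chart_cinv_cmap[OF chart] by auto
  have N0K0: "N0 \<subseteq> K0" "N0 \<subseteq> U"
  proof -
    have "x \<in> K0 \<and> x \<in> U" if "x \<in> N0" for x
    proof -
      have x: "x \<in> cdom c" "cmap c x \<in> cball y0 r" using that by (auto simp: N0_def)
      then show ?thesis
        using ci(1)[OF x(2)] chart_cinv_cmap[OF chart x(1)] by (auto simp: K0_def intro: image_eqI[where x="cmap c x"])
    qed
    then show "N0 \<subseteq> K0" "N0 \<subseteq> U" by auto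
  qed
  have "cball y0 r \<subseteq> cmap c ` cdom c" using r(4) by blast
  then have "compact K0"
    unfolding K0_def by (intro compact_continuous_image continuous_on_subset[OF cont_ci]) auto
  define W where "W = (\<Union>g. \<Phi> g ` N0)"
  have openW: "open W"
    unfolding W_def N0_def by (intro saturation_open[OF ctx] chart_open_preimage[OF chart]) simp
  have "m \<in> N0" using c(2) r(1) by (simp add: N0_def y0_def)
  then have mW: "m \<in> W" using action_one[OF ctx, of m] unfolding W_def by (metis UN_I UNIV_I imageI)
  have WU: "W \<subseteq> U" using N0K0(2) U(2) by (auto simp: W_def)
  have "C * r\<^sup>2 \<le> f z" if z: "z \<in> frontier W" for z
  proof -
    have "W \<subseteq> (\<Union>g. \<Phi> g ` K0)" using N0K0(1) by (auto simp: W_def)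
    then have "closure W \<subseteq> (\<Union>g. \<Phi> g ` K0)"
      using proper_action_closed_saturation[OF proper \<open>compact K0\<close>] closure_minimal by blast
    then obtain g x where x: "x \<in> K0" "z = \<Phi> g x"
      using z by (auto simp: frontier_def)
    have "z \<notin> W" using z openW by (simp add: frontier_def interior_open)
    \<comment> \<open>As \<open>W\<close> is invariant, the whole orbit of \<open>x\<close> avoids the chart ball.\<close>
    have outside: "\<Phi> g' x \<notin> N0" for g'
    proof
      assume "\<Phi> g' x \<in> N0"
      moreover have "z = \<Phi> (g \<otimes>\<^bsub>G\<^esub> inv\<^bsub>G\<^esub> g') (\<Phi> g' x)"
        by (simp add: x(2) action_mult[OF ctx] action_inverse[OF ctx])
      ultimately show False using \<open>z \<notin> W\<close> by (auto simp: W_def)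
    qed
    obtain y where y: "y \<in> cball y0 r" "x = cinv c y" using x(1) by (auto simp: K0_def)
    have xc: "x \<in> cdom c" "cmap c x = y" using ci[OF y(1)] y(2) by auto
    define h where "h = y - y0"
    have "y \<notin> ball y0 r" using outside[of "\<one>\<^bsub>G\<^esub>"] xc by (simp add: action_one[OF ctx] N0_def)
    then have hr: "norm h = r" using y(1) by (simp add: h_def dist_norm norm_minus_commute)
    have min: "norm (cmap c x - y0) \<le> norm (cmap c (\<Phi> g' x) - y0)" if "\<Phi> g' x \<in> cdom c" for g'
      using outside[of g'] that hr by (simp add: N0_def xc(2) h_def dist_norm norm_minus_commute)
    have "\<bar>h \<bullet> k\<bar> \<le> \<theta> * norm h" if k: "k \<in> N" for k
    proof -
      have "h \<bullet> chart_generator G \<Phi> c d (\<eta> k) y = 0"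
        using orbit_minimizer_orthogonal[OF ctx xc(1) min] by (simp add: xc(2) h_def)
      then have "\<bar>h \<bullet> k\<bar> = \<bar>h \<bullet> (chart_generator G \<Phi> c d (\<eta> k) y - k)\<bar>"
        by (simp add: inner_diff_right)
      also have "\<dots> \<le> norm h * norm (chart_generator G \<Phi> c d (\<eta> k) y - k)"
        by (rule Cauchy_Schwarz_ineq2)
      also have "\<dots> \<le> norm h * \<theta>"
        using \<rho>(2)[OF _ k, of y] hr r(3) by (intro mult_left_mono) (auto simp: dist_norm h_def)
      finally show ?thesis by (simp add: mult.commute)
    qed
    then have "C * (norm h)\<^sup>2 \<le> \<phi> (y0 + h) - \<phi> y0"
      using hr r(2) by (intro grow(4)) simp_all
    moreover have "\<phi> (y0 + h) = f x" "\<phi> y0 = 0"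
      using y(2) fm chart_cinv_cmap[OF chart c(2)] by (simp_all add: \<phi>_def h_def y0_def)
    moreover have "f z = f x"
      using inv B by (simp add: invariant_function_def lie_group_def x(2))
    ultimately show ?thesis by (simp add: hr)
  qed
  moreover have "C * r\<^sup>2 > 0" using grow(1) r(1) by simp
  ultimately show ?thesis using openW mW WU by blast
qed

theorem theorem1:
  fixes A :: "('m::{t2_space,second_countable_topology}, 'e::{real_inner,heine_borel}) chart set"
    and B :: "('g::{t2_space,second_countable_topology}, 'h::{real_inner,heine_borel}) chart set"
    and G :: "('g, 'r) monoid_scheme"
    and \<Phi> :: "'g \<Rightarrow> 'm \<Rightarrow> 'm"
    and X :: "'m \<Rightarrow> ('m, 'e) chart \<Rightarrow> 'e"
    and F :: "real \<Rightarrow> 'm \<Rightarrow> 'm"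
    and f :: "'m \<Rightarrow> real"
    and m :: 'm
  assumes "smooth_manifold A"
    and "lie_group B G"
    and "smooth_action B G A \<Phi>"
    and "proper_action \<Phi>"
    and "smooth_vector_field A X"
    and "equivariant_field A G \<Phi> X"
    and "flow_of A X F"
    and "relative_equilibrium B G A \<Phi> X m"
    and "smooth_map A vec_atlas f"
    and "invariant_function G \<Phi> f"
    and "critical_point A f m"
    and "f m = 0"
    and "pos_semidefinite_on (tangent_space A m) (hessian A f m)"
    and "form_kernel (tangent_space A m) (hessian A f m) = orbit_tangent_space B G A \<Phi> m"
    and "\<And>\<epsilon>::real. \<epsilon> > 0 \<Longrightarrow> \<exists>V. open V \<and> m \<in> V \<and> (\<forall>t>0. f ` (F t ` V) \<subseteq> {0..<\<epsilon>})"
  shows "stable_modulo (carrier G) \<Phi> F m"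
proof (rule stable_modulo_if_barriers)
  have G: "carrier G = UNIV" using assms(2) by (simp add: lie_group_def)
  have "\<exists>c\<in>A. m \<in> cdom c" "\<exists>d\<in>B. \<one>\<^bsub>G\<^esub> \<in> cdom d"
    using chart_around assms(1,2) unfolding lie_group_def by blast+
  then have one: "\<Phi> \<one>\<^bsub>G\<^esub> m = m" using action_one[OF assms(1-3)] by blast
  show "F 0 x = x" for x using assms(7) by (simp add: flow_of_def)
  show "continuous_on UNIV (\<lambda>t. F t x)" for x using assms(7) by (rule flow_continuous)
  show "\<exists>V. open V \<and> m \<in> V \<and> (\<forall>t>0. f ` (F t ` V) \<subseteq> {0..<\<epsilon>})" if "\<epsilon> > 0" for \<epsilon> :: real
    using that by (rule assms(15))
  show "\<exists>W \<epsilon>. open W \<and> m \<in> W \<and> W \<subseteq> U \<and> \<epsilon> > 0 \<and> (\<forall>z\<in>frontier W. \<epsilon> \<le> f z)"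
    if U: "open U" "\<And>g. g \<in> carrier G \<Longrightarrow> \<Phi> g ` U \<subseteq> U" "(\<lambda>g. \<Phi> g m) ` carrier G \<subseteq> U" for U
  proof (rule invariant_barrier[OF assms(1-4,9-14) U(1)])
    show "\<Phi> g ` U \<subseteq> U" for g using U(2) G by blast
    show "m \<in> U" using U(3) one G by (metis UNIV_I image_subset_iff)
  qed
qed

end
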